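(* For every integer $n\ge 1$, $p(\delta_{n+2}/\delta_n)=2^{n+2}s_n$.
   Context: $\delta_m=(m-1,\dots,1)$. Matrix coordinates: $[\lambda]=\{(i,j):1\le j\le\lambda_i\}$. A descending chain of length $s$ in $S\subseteq[\lambda]$ is a sequence of cells $(i_1,j_1),\dots,(i_s,j_s)$ of $S$ with $i_1<\cdots<i_s$ and $j_1<\cdots<j_s$. For an integer $k$, $\square^\lambda_k$ is the largest rectangle with $i$ rows and $i+k$ columns (some $i\ge0$) with northwest corner $(1,1)$ contained in $[\lambda]$, and the $k$th diagonal of $\lambda/\mu$ is $\{(i,j)\in[\lambda]\setminus[\mu]: j-i=k\}$. A pleasant diagram of $\lambda/\mu$ is a subset $S\subseteq[\lambda]$ such that for every integer $k$ with $1-\ell(\lambda)\le k\le\lambda_1-1$, $S\cap\square^\lambda_k$ has no descending chain longer than the number of cells of the $k$th diagonal of $\lambda/\mu$; $p(\lambda/\mu)$ is the number of pleasant diagrams. $s_n$ is the $n$-th (small) Schröder number: the number of lattice paths from $(0,0)$ to $(2n,0)$ with steps $(1,1)$, $(1,-1)$, $(2,0)$ never going below the $x$-axis and with no $(2,0)$ step on the $x$-axis ($s_1=1,s_2=3,s_3=11$). *)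

theory Defs
  imports Main "HOL-Library.Product_Plus"
begin

text \<open>
  A partition is the list of its positive parts in weakly decreasing order, so the
  number of parts is the length of the list; cells are pairs (row, column), both counted from 1.
\<close>

definition part :: "nat list \<Rightarrow> nat \<Rightarrow> nat" where
  "part lam i = (if 1 \<le> i \<and> i \<le> length lam then lam ! (i - 1) else 0)"

definition diagram :: "nat list \<Rightarrow> (nat \<times> nat) set" where
  "diagram lam = {(i, j). 1 \<le> i \<and> 1 \<le> j \<and> j \<le> part lam i}"

definition staircase :: "nat \<Rightarrow> nat list" where
  "staircase m = rev [1..<m]"

definition descending_chain :: "(nat \<times> nat) set \<Rightarrow> (nat \<times> nat) list \<Rightarrow> bool" where
  "descending_chain S c \<longleftrightarrow>
     set c \<subseteq> S \<and> sorted_wrt (\<lambda>(i, j) (i', j'). i < i' \<and> j < j') c"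

definition rect :: "int \<Rightarrow> nat \<Rightarrow> (nat \<times> nat) set" where
  "rect k i = {(a, b). 1 \<le> a \<and> a \<le> i \<and> 1 \<le> b \<and> int b \<le> int i + k}"

text \<open>
  The side condition \<^term>\<open>0 \<le> int i + k\<close> says that there are \<^term>\<open>int i + k\<close> columns.
  Admissible values of \<^term>\<open>i\<close> always exist and are bounded, so the maximum is attained.
\<close>

definition square :: "nat list \<Rightarrow> int \<Rightarrow> (nat \<times> nat) set" where
  "square lam k = rect k (GREATEST i. 0 \<le> int i + k \<and> rect k i \<subseteq> diagram lam)"

definition diagonal :: "nat list \<Rightarrow> nat list \<Rightarrow> int \<Rightarrow> (nat \<times> nat) set" where
  "diagonal lam mu k = {(i, j) \<in> diagram lam - diagram mu. int j - int i = k}"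

definition pleasant_diagram :: "nat list \<Rightarrow> nat list \<Rightarrow> (nat \<times> nat) set \<Rightarrow> bool" where
  "pleasant_diagram lam mu S \<longleftrightarrow>
     S \<subseteq> diagram lam \<and>
     (\<forall>k. 1 - int (length lam) \<le> k \<and> k \<le> int (part lam 1) - 1 \<longrightarrow>
        (\<forall>c. descending_chain (S \<inter> square lam k) c \<longrightarrow> length c \<le> card (diagonal lam mu k)))"

definition num_pleasant :: "nat list \<Rightarrow> nat list \<Rightarrow> nat" where
  "num_pleasant lam mu = card {S. pleasant_diagram lam mu S}"

text \<open>
  A lattice path starting at the origin is its list of steps; the point reached after
  \<^term>\<open>i\<close> steps is \<^term>\<open>sum_list (take i w)\<close>.
\<close>

definition schroeder_path :: "nat \<Rightarrow> (int \<times> int) list \<Rightarrow> bool" where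
  "schroeder_path n w \<longleftrightarrow>
     set w \<subseteq> {(1, 1), (1, -1), (2, 0)} \<and>
     sum_list w = (2 * int n, 0) \<and>
     (\<forall>i \<le> length w. 0 \<le> snd (sum_list (take i w))) \<and>
     (\<forall>i < length w. w ! i = (2, 0) \<longrightarrow> snd (sum_list (take i w)) \<noteq> 0)"

definition schroeder :: "nat \<Rightarrow> nat" where
  "schroeder n = card {w. schroeder_path n w}"

lemma finite_diagram: "finite (diagram lam)"
proof -
  have "diagram lam \<subseteq> {..length lam} \<times> {..sum_list lam}"
    by (auto simp: diagram_def part_def split: if_splits
        intro: order_trans[OF _ member_le_sum_list])
  then show ?thesis
    by (rule finite_subset) auto
qed

lemma finite_pleasant_diagrams: "finite {S. pleasant_diagram lam mu S}"
  by (rule finite_subset[of _ "Pow (diagram lam)"])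
    (auto simp: pleasant_diagram_def finite_diagram)

lemma finite_schroeder_paths: "finite {w. schroeder_path n w}"
proof -
  have len: "int (length w) \<le> fst (sum_list w)"
    if "set w \<subseteq> {(1, 1), (1, -1), (2, 0)}" for w :: "(int \<times> int) list"
    using that by (induction w) auto
  have "{w. schroeder_path n w} \<subseteq>
      {w. set w \<subseteq> {(1, 1), (1, -1), (2, 0)} \<and> length w \<le> 2 * n}"
  proof
    fix w assume "w \<in> {w. schroeder_path n w}"
    then have w: "set w \<subseteq> {(1, 1), (1, -1), (2, 0)}" "sum_list w = (2 * int n, 0)"
      by (simp_all add: schroeder_path_def)
    from len[OF w(1)] have "length w \<le> 2 * n"
      unfolding w(2) by simp
    with w(1) show "w \<in> {w. set w \<subseteq> {(1, 1), (1, -1), (2, 0)} \<and> length w \<le> 2 * n}"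
      by blast
  qed
  then show ?thesis
    by (rule finite_subset) (rule finite_lists_length_le, simp)
qed

lemma square_attained:
  defines "g \<equiv> \<lambda>lam k. GREATEST i. 0 \<le> int i + k \<and> rect k i \<subseteq> diagram lam"
  shows "0 \<le> int (g lam k) + k" "rect k (g lam k) \<subseteq> diagram lam"
    and "0 \<le> int i + k \<Longrightarrow> rect k i \<subseteq> diagram lam \<Longrightarrow> i \<le> g lam k"
proof -
  let ?P = "\<lambda>i. 0 \<le> int i + k \<and> rect k i \<subseteq> diagram lam"
  have ex: "?P (nat (- k))"
    by (auto simp: rect_def)
  have bd: "i \<le> length lam + nat \<bar>k\<bar>" if "?P i" for i
  proof (rule ccontr)
    assume "\<not> ?thesis"
    then have "(i, 1) \<in> rect k i" "length lam < i"
      by (auto simp: rect_def)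
    with that show False
      by (auto simp: diagram_def part_def)
  qed
  have "?P (g lam k)"
    unfolding g_def by (rule GreatestI_nat[where P = ?P, OF ex]) (use bd in blast)
  then show "0 \<le> int (g lam k) + k" "rect k (g lam k) \<subseteq> diagram lam"
    by auto
  show "i \<le> g lam k" if "0 \<le> int i + k" "rect k i \<subseteq> diagram lam"
    unfolding g_def by (rule Greatest_le_nat[where P = ?P]) (use that bd in blast)+
qed

end

theory Submission
  imports Defs "HOL-Computational_Algebra.Formal_Power_Series"
begin

text \<open>
  Every diagonal of \<open>\<delta>\<^bsub>n+2\<^esub>/\<delta>\<^sub>n\<close> is a single cell, and each cell of \<open>\<delta>\<^bsub>n+2\<^esub>\<close> lies, with
  everything northwest of it, in the rectangle of its own diagonal; hence a subset is pleasant iff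
  it has no descending chain of two cells. The numbers \<open>F(i, h)\<close> of such subsets of truncated
  staircases whose rows have, from the bottom up, \<open>h+1, ..., h+i\<close> cells satisfy
  \<open>F(i, h) = 2 (F(i-1, h+1) + F(i, h-1) - F(i-1, h))\<close>. If \<open>P\<close> is the power series with
  \<open>P = 1 + X (2P - 1) P\<close>, the solution is \<open>2\<^bsup>i+h\<^esup>\<close> times the coefficient of \<open>X\<^bsup>i-1\<^esup>\<close> in
  \<open>(2P - 1) P\<^sup>h\<close>. The first-step recursion for Schroeder paths started at height \<open>h\<close> is solved
  by \<open>P (2P - 1)\<^sup>h\<close>, so \<open>P\<close> is the generating function of the small Schroeder numbers.
\<close>

section \<open>The generating function of the small Schroeder numbers\<close>

text \<open>Coefficientwise form of the functional equation of \<open>P\<close>. The factor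
  \<open>2 * schr i - (if i = 0 then 1 else 0)\<close> is the large Schroeder number.\<close>

fun schr :: "nat \<Rightarrow> int" where
  "schr 0 = 1"
| "schr (Suc n) = (\<Sum>i\<le>n. (2 * schr i - (if i = 0 then 1 else 0)) * schr (n - i))"

definition schr_fps :: "int fps" where
  "schr_fps = Abs_fps schr"

lemma two_schr_fps_minus_1_nth:
  "fps_nth (2 * schr_fps - 1) i = 2 * schr i - (if i = 0 then 1 else 0)"
  by (simp add: schr_fps_def numeral_fps_const)

lemma schr_fps_eq: "schr_fps = 1 + fps_X * ((2 * schr_fps - 1) * schr_fps)"
proof (rule fps_ext)
  fix n
  show "fps_nth schr_fps n = fps_nth (1 + fps_X * ((2 * schr_fps - 1) * schr_fps)) n"
  proof (cases n)
    case 0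
    then show ?thesis by (simp add: schr_fps_def)
  next
    case (Suc m)
    have "fps_nth ((2 * schr_fps - 1) * schr_fps) m =
        (\<Sum>i\<le>m. (2 * schr i - (if i = 0 then 1 else 0)) * schr (m - i))"
      unfolding fps_mult_nth two_schr_fps_minus_1_nth by (simp add: schr_fps_def atLeast0AtMost)
    then show ?thesis
      using Suc by (simp add: schr_fps_def)
  qed
qed

section \<open>Schroeder paths\<close>

text \<open>Schroeder paths lifted to start at height \<open>h\<close> and to return to the axis at
  width \<open>m\<close>. With integer arguments the first-step recursion may run into impossible
  values, where the set is empty.\<close>

definition paths :: "int \<Rightarrow> int \<Rightarrow> (int \<times> int) list set" where
  "paths h m = {w. set w \<subseteq> {(1, 1), (1, -1), (2, 0)} \<and>
     sum_list w = (m, - h) \<and>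
     (\<forall>i \<le> length w. 0 \<le> h + snd (sum_list (take i w))) \<and>
     (\<forall>i < length w. w ! i = (2, 0) \<longrightarrow> h + snd (sum_list (take i w)) \<noteq> 0)}"

lemma schroeder_eq_card_paths: "schroeder n = card (paths 0 (2 * int n))"
  by (simp add: schroeder_def paths_def schroeder_path_def)

lemma Nil_in_paths: "[] \<in> paths h m \<longleftrightarrow> h = 0 \<and> m = 0"
  by (auto simp: paths_def zero_prod_def)

lemma Cons_in_paths:
  "s # w \<in> paths h m \<longleftrightarrow> s \<in> {(1, 1), (1, -1), (2, 0)} \<and> 0 \<le> h \<and> (s = (2, 0) \<longrightarrow> h \<noteq> 0) \<and>
     w \<in> paths (h + snd s) (m - fst s)"
proof -
  have A: "(\<forall>i \<le> length (s # w). 0 \<le> h + snd (sum_list (take i (s # w)))) \<longleftrightarrow>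
     0 \<le> h \<and> (\<forall>i \<le> length w. 0 \<le> h + snd s + snd (sum_list (take i w)))"
    by (simp add: less_Suc_eq_le[symmetric] All_less_Suc2 add.assoc)
  have B: "(\<forall>i < length (s # w). (s # w) ! i = (2, 0) \<longrightarrow> h + snd (sum_list (take i (s # w))) \<noteq> 0) \<longleftrightarrow>
     (s = (2, 0) \<longrightarrow> h \<noteq> 0) \<and>
     (\<forall>i < length w. w ! i = (2, 0) \<longrightarrow> h + snd s + snd (sum_list (take i w)) \<noteq> 0)"
    by (simp add: All_less_Suc2 add.assoc)
  have C: "sum_list (s # w) = (m, - h) \<longleftrightarrow> sum_list w = (m - fst s, - (h + snd s))"
    by (auto simp: prod_eq_iff)
  show ?thesis
    unfolding paths_def mem_Collect_eq A B C by auto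
qed

text \<open>No step descends by more than its width.\<close>

lemma paths_height_le_width: "w \<in> paths h m \<Longrightarrow> 0 \<le> h \<and> h \<le> m"
proof (induction w arbitrary: h m)
  case Nil
  then show ?case by (simp add: Nil_in_paths)
next
  case (Cons s w)
  from Cons.prems have "0 \<le> h" "s \<in> {(1, 1), (1, -1), (2, 0)}"
    "w \<in> paths (h + snd s) (m - fst s)"
    by (simp_all add: Cons_in_paths)
  with Cons.IH[of "h + snd s" "m - fst s"] show ?case by auto
qed

lemma paths_empty: "h < 0 \<or> m < h \<Longrightarrow> paths h m = {}"
  using paths_height_le_width by fastforce

lemma paths_first_step:
  assumes "0 \<le> h"
  shows "paths h m = (if h = 0 \<and> m = 0 then {[]} else {}) \<union>
    (#) (1, 1) ` paths (h + 1) (m - 1) \<union> (#) (1, -1) ` paths (h - 1) (m - 1) \<union>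
    (if h = 0 then {} else (#) (2, 0) ` paths h (m - 2))"
    (is "_ = ?R")
proof (rule set_eqI)
  fix w
  show "w \<in> paths h m \<longleftrightarrow> w \<in> ?R"
    using assms by (cases w) (auto simp: Nil_in_paths Cons_in_paths)
qed

lemma finite_paths: "finite (paths h m)"
proof -
  have "finite (paths h m)" if "m \<le> int k" for k
    using that
  proof (induction k arbitrary: h m rule: less_induct)
    case (less k)
    show ?case
    proof (cases "0 \<le> h \<and> h \<le> m \<and> 0 < m")
      case True
      with less.prems have "0 < k" by simp
      then have "finite (paths h' (m - 1))" "finite (paths h' (m - 2))" for h'
        using less.prems by (auto intro!: less.IH[of "k - 1"])
      with True show ?thesis
        by (subst paths_first_step) auto
    next
      case False
      then consider "h < 0 \<or> m < h" | "h = 0" "m = 0" by linarith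
      then show ?thesis
        by cases (auto simp: paths_empty paths_first_step[of 0 0])
    qed
  qed
  from this[of "nat m"] show ?thesis by simp
qed

lemma card_paths_first_step:
  assumes "0 \<le> h"
  shows "card (paths h m) = (if h = 0 \<and> m = 0 then 1 else 0) +
    card (paths (h + 1) (m - 1)) + card (paths (h - 1) (m - 1)) +
    (if h = 0 then 0 else card (paths h (m - 2)))"
proof -
  have [simp]: "card ((#) s ` paths a b) = card (paths a b)" for s a b
    by (simp add: card_image)
  have 1: "card (A \<union> B \<union> C \<union> D) = card A + card B + card C + card D"
    if "finite A" "finite B" "finite C" "finite D" "A \<inter> B = {}" "A \<inter> C = {}" "A \<inter> D = {}"
      "B \<inter> C = {}" "B \<inter> D = {}" "C \<inter> D = {}" for A B C D :: "(int \<times> int) list set"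
    using that by (simp add: card_Un_disjoint Int_Un_distrib2)
  show ?thesis
    by (subst paths_first_step[OF assms], subst 1) (auto simp: finite_paths)
qed

text \<open>A path from height \<open>h\<close> splits at its first descents to \<open>h - 1\<close>, ..., \<open>0\<close>; each of the
  \<open>h\<close> pieces is a large Schroeder path, with generating function \<open>2 * schr_fps - 1\<close>.\<close>

lemma card_paths:
  "int (card (paths (int h) (int h + 2 * int m))) =
     fps_nth (schr_fps * (2 * schr_fps - 1) ^ h) m"
\<comment> \<open>The measure is the width of the path: a first step up, down or flat leads to
  \<open>(h + 1, m - 1)\<close>, \<open>(h - 1, m)\<close> or \<open>(h, m - 1)\<close>.\<close>
proof (induction "h + 2 * m" arbitrary: h m rule: less_induct)
  case less
  let ?R = "2 * schr_fps - 1" and ?Q = "\<lambda>h. schr_fps * (2 * schr_fps - 1) ^ h"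
  have Q0: "?Q 0 = 1 + fps_X * ?Q 1"
    using schr_fps_eq by (simp add: algebra_simps)
  \<comment> \<open>The functional equation of the large Schroeder numbers, by
    \<open>2 * schr_fps = ?R + 1\<close>.\<close>
  have R: "?R = 1 + fps_X * (?R ^ 2 + ?R)"
  proof -
    have "?R = 2 * (1 + fps_X * (?R * schr_fps)) - 1"
      by (subst (1) schr_fps_eq) simp
    also have "\<dots> = 1 + fps_X * (?R ^ 2 + ?R)"
      by (simp add: algebra_simps power2_eq_square)
    finally show ?thesis .
  qed
  \<comment> \<open>Multiplying \<open>R\<close> by \<open>?Q h\<close> gives one summand each for a
    first step down, up and flat.\<close>
  have Q: "?Q (Suc h) = ?Q h + fps_X * (?Q (Suc (Suc h)) + ?Q (Suc h))" for h
  proof -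
    have "?Q (Suc h) = ?Q h * ?R" by simp
    also have "\<dots> = ?Q h * (1 + fps_X * (?R ^ 2 + ?R))"
      by (subst R[symmetric]) simp
    also have "\<dots> = ?Q h + fps_X * (?Q (Suc (Suc h)) + ?Q (Suc h))"
      by (simp add: algebra_simps power2_eq_square)
    finally show ?thesis .
  qed
  have up: "int (card (paths (int h + 1) (int h + 2 * int m - 1))) = fps_nth (fps_X * ?Q (Suc h)) m"
  proof (cases m)
    case 0
    then show ?thesis by (simp add: paths_empty)
  next
    case (Suc m')
    have "int (card (paths (int (Suc h)) (int (Suc h) + 2 * int m'))) = fps_nth (?Q (Suc h)) m'"
      by (rule less) (simp add: Suc)
    then show ?thesis
      using Suc by (simp add: algebra_simps)
  qed
  show ?case
  proof (cases h)
    case 0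
    have "int (card (paths 0 (2 * int m))) = fps_nth (1 + fps_X * ?Q 1) m"
      using up 0 by (simp add: card_paths_first_step[of 0] paths_empty)
    then show ?thesis
      unfolding 0 Q0 by simp
  next
    case (Suc h')
    have down: "int (card (paths (int h - 1) (int h + 2 * int m - 1))) = fps_nth (?Q h') m"
    proof -
      have "int (card (paths (int h') (int h' + 2 * int m))) = fps_nth (?Q h') m"
        by (rule less) (simp add: Suc)
      then show ?thesis
        using Suc by (simp add: algebra_simps)
    qed
    have flat: "int (card (paths (int h) (int h + 2 * int m - 2))) = fps_nth (fps_X * ?Q h) m"
    proof (cases m)
      case 0
      then show ?thesis by (simp add: paths_empty)
    next
      case (Suc m')
      have "int (card (paths (int h) (int h + 2 * int m'))) = fps_nth (?Q h) m'"
        by (rule less) (simp add: Suc)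
      then show ?thesis
        using Suc by (simp add: algebra_simps)
    qed
    have "int (card (paths (int h) (int h + 2 * int m))) =
        fps_nth (?Q h' + fps_X * (?Q (Suc h) + ?Q h)) m"
      using up down flat Suc
      by (subst card_paths_first_step) (simp_all add: distrib_left del: fps_X_mult_nth power_Suc)
    then show ?thesis
      unfolding Suc Q[of h', symmetric] .
  qed
qed

lemma schroeder_eq_schr: "int (schroeder n) = schr n"
  using card_paths[of 0 n] by (simp add: schroeder_eq_card_paths schr_fps_def)

section \<open>Subsets without descending pairs\<close>

definition descent_free :: "(nat \<times> nat) set \<Rightarrow> bool" where
  "descent_free S \<longleftrightarrow> (\<forall>(a, b) \<in> S. \<forall>(c, d) \<in> S. \<not> (a < c \<and> b < d))"

text \<open>The southwest corner is \<open>(i, j)\<close>, and for \<open>i + j + h = M\<close> the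
  bottom row has \<open>h + 1\<close> cells, each higher row one more.\<close>

definition corner_region :: "nat \<Rightarrow> nat \<Rightarrow> nat \<Rightarrow> (nat \<times> nat) set" where
  "corner_region M i j = {(a, b). 1 \<le> a \<and> a \<le> i \<and> j \<le> b \<and> a + b \<le> M}"

definition free_subsets :: "(nat \<times> nat) set \<Rightarrow> (nat \<times> nat) set set" where
  "free_subsets R = {S. S \<subseteq> R \<and> descent_free S}"

lemma finite_corner_region: "finite (corner_region M i j)"
  by (rule finite_subset[of _ "{..i} \<times> {..M}"]) (auto simp: corner_region_def)

lemma finite_free_subsets: "finite R \<Longrightarrow> finite (free_subsets R)"
  unfolding free_subsets_def by (rule finite_subset[of _ "Pow R"]) auto

lemma corner_region_0: "corner_region M 0 j = {}"
  by (auto simp: corner_region_def)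

text \<open>The extra row would start beyond the antidiagonal. This is the boundary rule
  \<open>F(i, -1) = F(i-1, 0)\<close>.\<close>

lemma corner_region_outside:
  "M < Suc i + j \<Longrightarrow> corner_region M (Suc i) j = corner_region M i j"
  by (auto simp: corner_region_def le_Suc_eq)

lemma card_free_subsets_empty: "card (free_subsets {}) = 1"
proof -
  have "free_subsets {} = {{}}"
    by (auto simp: free_subsets_def descent_free_def)
  then show ?thesis by simp
qed

text \<open>The corner cell forms a descending pair with no other cell, so it is free; without it, a
  set cannot meet both its row and its column.\<close>

lemma card_free_subsets_corner:
  assumes "Suc i + j \<le> M"
  shows "card (free_subsets (corner_region M (Suc i) j)) +
      2 * card (free_subsets (corner_region M i (Suc j))) =
    2 * (card (free_subsets (corner_region M i j)) +
         card (free_subsets (corner_region M (Suc i) (Suc j))))"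
proof -
  let ?F = "\<lambda>i j. free_subsets (corner_region M i j)"
  define G where "G = free_subsets (corner_region M (Suc i) j - {(Suc i, j)})"
  have fin [simp]: "finite (?F a b)" for a b
    by (simp add: finite_free_subsets finite_corner_region)
  have corner: "(Suc i, j) \<in> corner_region M (Suc i) j"
    using assms by (auto simp: corner_region_def)
  have finG: "finite G"
    by (simp add: G_def finite_free_subsets finite_corner_region)
  have ins: "descent_free (insert (Suc i, j) S) \<longleftrightarrow> descent_free S"
    if "S \<subseteq> corner_region M (Suc i) j" for S
    using that by (fastforce simp: descent_free_def corner_region_def)
  have F: "?F (Suc i) j = G \<union> insert (Suc i, j) ` G"
  proof (rule set_eqI)
    fix S
    show "S \<in> ?F (Suc i) j \<longleftrightarrow> S \<in> G \<union> insert (Suc i, j) ` G"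
    proof
      assume S: "S \<in> ?F (Suc i) j"
      show "S \<in> G \<union> insert (Suc i, j) ` G"
      proof (cases "(Suc i, j) \<in> S")
        case True
        then have "S = insert (Suc i, j) (S - {(Suc i, j)})" by blast
        moreover have "S - {(Suc i, j)} \<in> G"
          using S by (auto simp: G_def free_subsets_def descent_free_def)
        ultimately show ?thesis by blast
      next
        case False
        with S show ?thesis by (auto simp: G_def free_subsets_def)
      qed
    next
      assume "S \<in> G \<union> insert (Suc i, j) ` G"
      then show "S \<in> ?F (Suc i) j"
        using ins corner by (auto simp: G_def free_subsets_def)
    qed
  qed
  have "inj_on (insert (Suc i, j)) G"
    by (rule inj_onI) (auto simp: G_def free_subsets_def)
  moreover have "G \<inter> insert (Suc i, j) ` G = {}"
    by (auto simp: G_def free_subsets_def)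
  ultimately have 1: "card (?F (Suc i) j) = 2 * card G"
    using finG by (simp add: F card_Un_disjoint card_image)
  have "G = ?F i j \<union> ?F (Suc i) (Suc j)"
  proof (rule set_eqI)
    fix S
    show "S \<in> G \<longleftrightarrow> S \<in> ?F i j \<union> ?F (Suc i) (Suc j)"
    proof
      assume S: "S \<in> G"
      then have sub: "S \<subseteq> corner_region M (Suc i) j" "(Suc i, j) \<notin> S" and "descent_free S"
        by (auto simp: G_def free_subsets_def)
      have "\<not> ((Suc i, b) \<in> S \<and> (a, j) \<in> S)" for a b
      proof
        assume ab: "(Suc i, b) \<in> S \<and> (a, j) \<in> S"
        with sub have "a \<noteq> Suc i" "b \<noteq> j" by auto
        moreover from ab sub have "a \<le> Suc i" "j \<le> b"
          by (auto simp: corner_region_def)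
        ultimately have "a < Suc i \<and> j < b" by simp
        with ab \<open>descent_free S\<close> show False
          unfolding descent_free_def by fastforce
      qed
      then consider "\<forall>b. (Suc i, b) \<notin> S" | "\<forall>a. (a, j) \<notin> S" by blast
      then show "S \<in> ?F i j \<union> ?F (Suc i) (Suc j)"
      proof cases
        case 1
        have "S \<subseteq> corner_region M i j"
        proof
          fix p assume p: "p \<in> S"
          with 1 have "fst p \<noteq> Suc i" by (cases p) auto
          with p sub show "p \<in> corner_region M i j"
            by (cases p) (fastforce simp: corner_region_def le_Suc_eq)
        qed
        with \<open>descent_free S\<close> show ?thesis by (simp add: free_subsets_def)
      next
        case 2
        have "S \<subseteq> corner_region M (Suc i) (Suc j)"
        proof
          fix p assume p: "p \<in> S"
          with 2 have "snd p \<noteq> j" by (cases p) auto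
          with p sub show "p \<in> corner_region M (Suc i) (Suc j)"
            by (cases p) (auto simp: corner_region_def subset_iff Suc_le_eq le_neq_implies_less)
        qed
        with \<open>descent_free S\<close> show ?thesis by (simp add: free_subsets_def)
      qed
    next
      assume "S \<in> ?F i j \<union> ?F (Suc i) (Suc j)"
      then show "S \<in> G"
        by (fastforce simp: G_def free_subsets_def corner_region_def)
    qed
  qed
  \<comment> \<open>Subsets of both regions are subsets of their intersection, so
    inclusion-exclusion applies to the two families.\<close>
  moreover have "?F i j \<inter> ?F (Suc i) (Suc j) = ?F i (Suc j)"
    by (fastforce simp: free_subsets_def corner_region_def)
  ultimately have "card G + card (?F i (Suc j)) = card (?F i j) + card (?F (Suc i) (Suc j))"
    using card_Un_Int[of "?F i j" "?F (Suc i) (Suc j)"] by simp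
  with 1 show ?thesis by simp
qed

lemma card_free_subsets:
  assumes "Suc i + j + h = M"
  shows "int (card (free_subsets (corner_region M (Suc i) j))) =
    2 ^ (Suc i + h) * fps_nth ((2 * schr_fps - 1) * schr_fps ^ h) i"
  using assms
proof (induction i arbitrary: h j)
  \<comment> \<open>In a single row every subset is free, giving \<open>2 ^ (h + 1)\<close>; the
    constant coefficient of \<open>(2P - 1) P^h\<close> is 1.\<close>
  case 0
  then show ?case
  proof (induction h arbitrary: j)
    case 0
    then show ?case
      using card_free_subsets_corner[of 0 j M] corner_region_outside[of M 0 "Suc j"]
      by (simp add: corner_region_0 card_free_subsets_empty schr_fps_def numeral_fps_const)
  next
    case (Suc h)
    have "int (card (free_subsets (corner_region M (Suc 0) (Suc j)))) = 2 ^ Suc h"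
      using Suc.IH[of "Suc j"] Suc.prems
      by (simp add: schr_fps_def numeral_fps_const fps_nth_power_0)
    then show ?case
      using card_free_subsets_corner[of 0 j M] Suc.prems
      by (simp add: corner_region_0 card_free_subsets_empty schr_fps_def numeral_fps_const
          fps_nth_power_0)
  qed
next
  case (Suc i)
  note IH = Suc.IH
  let ?F = "\<lambda>i j. int (card (free_subsets (corner_region M i j)))"
  let ?C = "\<lambda>h. (2 * schr_fps - 1) * schr_fps ^ h"
  \<comment> \<open>The functional equation of \<open>P\<close> times \<open>?C h\<close>; its three
    terms match those of the recursion for \<open>F\<close>.\<close>
  have C: "?C (Suc h) = ?C h + fps_X * (2 * ?C (Suc (Suc h)) - ?C (Suc h))" for h
  proof -
    have "?C (Suc h) = ?C h * schr_fps" by simp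
    also have "\<dots> = ?C h * (1 + fps_X * ((2 * schr_fps - 1) * schr_fps))"
      by (subst schr_fps_eq[symmetric]) simp
    also have "\<dots> = ?C h + fps_X * (2 * ?C (Suc (Suc h)) - ?C (Suc h))"
      by (simp add: algebra_simps)
    finally show ?thesis .
  qed
  have C0: "?C 0 = 1 + fps_X * (2 * ?C 1)"
  proof -
    have "?C 0 = 2 * (1 + fps_X * ((2 * schr_fps - 1) * schr_fps)) - 1"
      by (subst (1) schr_fps_eq) simp
    also have "\<dots> = 1 + fps_X * (2 * ?C 1)"
      by (simp add: algebra_simps)
    finally show ?thesis .
  qed
  have rec: "?F (Suc (Suc i)) j + 2 * ?F (Suc i) (Suc j) =
      2 * (?F (Suc i) j + ?F (Suc (Suc i)) (Suc j))" if "Suc (Suc i) + j \<le> M" for j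
    using arg_cong[OF card_free_subsets_corner[OF that], of int] by simp
  have two_nth: "fps_nth (2 * f) k = 2 * fps_nth f k" for f :: "int fps" and k
    by (simp add: numeral_fps_const)
  have nth: "fps_nth (f + fps_X * (2 * g - k)) (Suc i) =
      fps_nth f (Suc i) + 2 * fps_nth g i - fps_nth k i" for f g k :: "int fps"
    by (simp add: two_nth)
  \<comment> \<open>The outer 2 stays on \<open>b\<close>, whose index sum equals that of the left
    side; for \<open>a\<close> and \<open>c\<close> the sum is one less and the power of 2 absorbs
    it.\<close>
  have factor: "2 * (2 ^ (Suc i + Suc (Suc h)) * b + 2 ^ (Suc (Suc i) + h) * a
      - 2 ^ (Suc i + Suc h) * c) = 2 ^ (Suc (Suc i) + Suc h) * (a + 2 * b - c)"
    for a b c :: int and h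
    by (simp add: algebra_simps)
  from Suc.prems show ?case
  proof (induction h arbitrary: j)
    case 0
    \<comment> \<open>At \<open>h = 0\<close> the boundary rule cancels the last two terms of the
      recursion.\<close>
    have "?F (Suc (Suc i)) (Suc j) = ?F (Suc i) (Suc j)"
      using 0 by (simp add: corner_region_outside)
    then have "?F (Suc (Suc i)) j = 2 * ?F (Suc i) j"
      using rec[of j] 0 by simp
    also have "\<dots> = 2 * (2 ^ (Suc i + 1) * fps_nth (?C 1) i)"
      using IH[of j 1] 0 by simp
    also have "\<dots> = 2 ^ (Suc (Suc i) + 0) * fps_nth (1 + fps_X * (2 * ?C 1)) (Suc i)"
      by (simp add: two_nth)
    finally show ?case
      unfolding C0 .
  next
    case (Suc h)
    have "?F (Suc (Suc i)) j =
        2 * (?F (Suc i) j + ?F (Suc (Suc i)) (Suc j) - ?F (Suc i) (Suc j))"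
      using rec[of j] Suc.prems by simp
    also have "\<dots> = 2 * (2 ^ (Suc i + Suc (Suc h)) * fps_nth (?C (Suc (Suc h))) i
        + 2 ^ (Suc (Suc i) + h) * fps_nth (?C h) (Suc i)
        - 2 ^ (Suc i + Suc h) * fps_nth (?C (Suc h)) i)"
      using IH[of j "Suc (Suc h)"]
        IH[of "Suc j" "Suc h"] Suc.IH[of "Suc j"] Suc.prems
      by simp
    also have "\<dots> = 2 ^ (Suc (Suc i) + Suc h) *
        fps_nth (?C h + fps_X * (2 * ?C (Suc (Suc h)) - ?C (Suc h))) (Suc i)"
      unfolding nth by (rule factor)
    finally show ?case
      unfolding C[symmetric] .
  qed
qed

section \<open>Pleasant diagrams of the thick border strip\<close>

lemma diagram_staircase: "diagram (staircase m) = {(i, j). 1 \<le> i \<and> 1 \<le> j \<and> i + j \<le> m}"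
  by (auto simp: diagram_def Defs.part_def staircase_def rev_nth split: if_splits)

text \<open>Cells of the strip have coordinate sum \<open>n + 1\<close> or \<open>n + 2\<close>, and
  the parity of \<open>k\<close> selects one of these.\<close>

lemma card_diagonal_staircase:
  assumes "- int n \<le> k" "k \<le> int n"
  shows "card (diagonal (staircase (n + 2)) (staircase n) k) = 1"
proof -
  define i where "i = nat ((int n + 2 - k) div 2)"
  define j where "j = nat (int i + k)"
  have i: "int i = (int n + 2 - k) div 2" and j: "int j = int i + k"
    using assms by (auto simp: i_def j_def)
  have "diagonal (staircase (n + 2)) (staircase n) k = {(i, j)}"
  proof (intro set_eqI iffI)
    fix p assume "p \<in> diagonal (staircase (n + 2)) (staircase n) k"
    then show "p \<in> {(i, j)}"
      using i j by (cases p) (auto simp: diagonal_def diagram_staircase)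
  next
    fix p assume "p \<in> {(i, j)}"
    then show "p \<in> diagonal (staircase (n + 2)) (staircase n) k"
      using i j assms by (auto simp: diagonal_def diagram_staircase)
  qed
  then show ?thesis by simp
qed

text \<open>The rectangle with southeast corner \<open>(c, d)\<close> fits into the staircase, so a
  descending pair ending at \<open>(c, d)\<close> is seen by the condition for the diagonal of that
  cell.\<close>

lemma rect_subset_square_staircase:
  assumes "1 \<le> c" "1 \<le> d" "c + d \<le> m"
  shows "rect (int d - int c) c \<subseteq> square (staircase m) (int d - int c)"
proof -
  have "rect (int d - int c) c \<subseteq> diagram (staircase m)"
    using assms by (auto simp: rect_def diagram_staircase)
  then have "c \<le> (GREATEST i. 0 \<le> int i + (int d - int c) \<and>
      rect (int d - int c) i \<subseteq> diagram (staircase m))"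
    by (intro square_attained(3)) auto
  then show ?thesis
    unfolding square_def by (auto simp: rect_def)
qed

lemma pleasant_iff_descent_free:
  "pleasant_diagram (staircase (n + 2)) (staircase n) S \<longleftrightarrow>
    S \<subseteq> diagram (staircase (n + 2)) \<and> descent_free S"
proof -
  \<comment> \<open>These turn the range of \<open>k\<close> into
    \<open>- n \<le> k \<le> n\<close>, where every diagonal is a single cell.\<close>
  have bounds: "length (staircase (n + 2)) = n + 1" "part (staircase (n + 2)) 1 = n + 1"
    by (simp_all add: staircase_def Defs.part_def rev_nth)
  show ?thesis
  proof
    assume P: "pleasant_diagram (staircase (n + 2)) (staircase n) S"
    then have S: "S \<subseteq> diagram (staircase (n + 2))"
      by (simp add: pleasant_diagram_def)
    have "\<not> (a < c \<and> b < d)" if "(a, b) \<in> S" "(c, d) \<in> S" for a b c d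
    proof
      assume lt: "a < c \<and> b < d"
      let ?k = "int d - int c"
      have cells: "1 \<le> a" "1 \<le> b" "1 \<le> c" "1 \<le> d" "c + d \<le> n + 2"
        using S that by (auto simp: diagram_staircase)
      then have k: "- int n \<le> ?k" "?k \<le> int n" by linarith+
      have "{(a, b), (c, d)} \<subseteq> rect ?k c"
        using cells lt by (auto simp: rect_def)
      then have "descending_chain (S \<inter> square (staircase (n + 2)) ?k) [(a, b), (c, d)]"
        using rect_subset_square_staircase[OF cells(3-5)] lt that
        by (auto simp: descending_chain_def)
      then have "length [(a, b), (c, d)] \<le> card (diagonal (staircase (n + 2)) (staircase n) ?k)"
        using P k unfolding pleasant_diagram_def bounds
        by (elim conjE allE[of _ ?k] impE) auto
      then show False
        unfolding card_diagonal_staircase[OF k] by simp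
    qed
    with S show "S \<subseteq> diagram (staircase (n + 2)) \<and> descent_free S"
      by (auto simp: descent_free_def)
  next
    assume S: "S \<subseteq> diagram (staircase (n + 2)) \<and> descent_free S"
    have "length c \<le> 1" if "descending_chain (S \<inter> T) c" for c T
    proof (rule ccontr)
      assume "\<not> length c \<le> 1"
      then obtain a b a' b' c' where "c = (a, b) # (a', b') # c'"
        by (cases c; cases "tl c") auto
      with that have "(a, b) \<in> S" "(a', b') \<in> S" "a < a' \<and> b < b'"
        by (auto simp: descending_chain_def)
      with S show False
        unfolding descent_free_def by blast
    qed
    with S show "pleasant_diagram (staircase (n + 2)) (staircase n) S"
      unfolding pleasant_diagram_def bounds using card_diagonal_staircase[of n] by simp
  qed
qed

theorem theorem9p1:
  fixes n :: nat
  assumes "n \<ge> 1"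
  shows "num_pleasant (staircase (n + 2)) (staircase n) = 2 ^ (n + 2) * schroeder n"
proof -
  have "{S. pleasant_diagram (staircase (n + 2)) (staircase n) S} =
      free_subsets (corner_region (n + 2) (Suc n) 1)"
    unfolding free_subsets_def pleasant_iff_descent_free
    by (fastforce simp: diagram_staircase corner_region_def)
  then have "int (num_pleasant (staircase (n + 2)) (staircase n)) =
      2 ^ Suc n * fps_nth (2 * schr_fps - 1) n"
    using card_free_subsets[of n 1 0 "n + 2"] by (simp add: num_pleasant_def)
  \<comment> \<open>As \<open>n\<close> is positive, the correction at index 0 vanishes and the
    coefficient is \<open>2 * schr n\<close>.\<close>
  also have "\<dots> = int (2 ^ (n + 2) * schroeder n)"
    unfolding two_schr_fps_minus_1_nth using assms by (simp add: schroeder_eq_schr)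
  finally show ?thesis
    by (simp only: of_nat_eq_iff)
qed

end
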